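(* Let $D$ be a non-empty finite set of positive integers and let $N$ be the maximum integer in $D$. Then $D$ is the signed degree set of some connected signed graph, and the minimum order (number of vertices) of such a signed graph, i.e. of a connected signed graph whose signed degree set is $D$, is $N+1$.
   Context: All graphs are finite, undirected, without loops and multiple edges. A signed graph is a graph in which each edge is assigned a positive or a negative sign. The signed degree of a vertex $v$ in a signed graph $G$, denoted $\mathrm{sdeg}(v)$, is the number of positive edges incident with $v$ minus the number of negative edges incident with $v$. The signed degree set of a signed graph $G$ is the set of distinct signed degrees of the vertices of $G$, i.e. $\{\mathrm{sdeg}(v) : v \in V(G)\}$. A signed graph is connected if its underlying graph (forgetting signs) is connected. *)

theory Defs
  imports "Graph_Theory.Digraph_Component"
begin

(* The underlying simple graph is a symmetric loop-free digraph without parallel arcs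
   (locale pair_graph): the edge uv is the pair of arcs (u,v), (v,u).  Signs are attached to
   two-element sets {u,v}, so each undirected edge carries exactly one sign; the values of
   is_positive on sets that are not edges are irrelevant. *)
record 'a signed_graph =
  underlying :: "'a pair_pre_digraph"
  is_positive :: "'a set \<Rightarrow> bool"

definition signed_graph :: "'a signed_graph \<Rightarrow> bool" where
  "signed_graph G \<longleftrightarrow> pair_graph (underlying G)"

definition vertices :: "'a signed_graph \<Rightarrow> 'a set" where
  "vertices G = pverts (underlying G)"

definition edges :: "'a signed_graph \<Rightarrow> 'a set set" where
  "edges G = {{u, v} | u v. (u, v) \<in> parcs (underlying G)}"

definition sdeg :: "'a signed_graph \<Rightarrow> 'a \<Rightarrow> int" where
  "sdeg G v = int (card {e \<in> edges G. v \<in> e \<and> is_positive G e})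
            - int (card {e \<in> edges G. v \<in> e \<and> \<not> is_positive G e})"

definition signed_degree_set :: "'a signed_graph \<Rightarrow> int set" where
  "signed_degree_set G = sdeg G ` vertices G"

definition connected_signed_graph :: "'a signed_graph \<Rightarrow> bool" where
  "connected_signed_graph G \<longleftrightarrow>
     signed_graph G \<and> Digraph_Component.connected (with_proj (underlying G))"

definition graph_order :: "'a signed_graph \<Rightarrow> nat" where
  "graph_order G = card (vertices G)"

end

theory Submission
  imports Defs
begin

text \<open>
  The lower bound is immediate: a vertex of a graph on \<open>n\<close> vertices has at most \<open>n - 1\<close> incident
  edges, so no signed degree exceeds \<open>n - 1\<close> (\<open>sdeg_less_order\<close>).

  For the upper bound all edges can be taken positive, so that signed degrees are ordinary degrees:
  some graph on the vertices \<open>0, \<dots>, N\<close> has degree set \<open>D\<close>, by a theorem of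
  Kapoor, Polimeni and Wall.  Such a graph is automatically connected, because a vertex of degree
  \<open>N\<close> is adjacent to all others (\<open>connected_if_dominating_vertex\<close>).

  The theorem on degree sets is proved in a form that is symmetric under complementation, which
  replaces the degree set \<open>D\<close> by \<open>N - D\<close>.  A graph on \<open>N + 1 \<ge> 2\<close> vertices cannot have both an
  isolated vertex and a vertex of degree \<open>N\<close>.  Conversely, every \<open>D \<subseteq> {0, \<dots>, N}\<close> that contains
  exactly one of \<open>0\<close> and \<open>N\<close> is a degree set (\<open>degree_set_if_one_extreme\<close>).  By induction on
  \<open>N\<close>: up to complementation \<open>0 \<in> D\<close>; then either \<open>D = {0}\<close> and the edgeless graph will do, or
  it suffices to add an isolated vertex to a graph on one vertex fewer.
\<close>

section \<open>Degree sets of ordinary graphs\<close>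

text \<open>
  Representing a graph by a symmetric relation \<open>A\<close> alone, without a vertex set, makes adding the
  isolated vertex \<open>N + 1\<close> a mere change of the bound: \<open>A\<close> itself stays the same.
\<close>

definition is_degree_set :: "nat \<Rightarrow> nat set \<Rightarrow> bool" where
  "is_degree_set N D \<longleftrightarrow>
     (\<exists>A. A \<subseteq> {..N} \<times> {..N} \<and> sym A \<and> irrefl A \<and> (\<lambda>v. card (A `` {v})) ` {..N} = D)"

lemma is_degree_set_complement:
  assumes "is_degree_set N D"
  shows "is_degree_set N ((\<lambda>d. N - d) ` D)"
proof -
  obtain A where A: "A \<subseteq> {..N} \<times> {..N}" "sym A" "irrefl A" "(\<lambda>v. card (A `` {v})) ` {..N} = D"
    using assms unfolding is_degree_set_def by blast
  define B where "B = {..N} \<times> {..N} - Id - A"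
  have "card (B `` {v}) = N - card (A `` {v})" if "v \<le> N" for v
  proof -
    have "B `` {v} = ({..N} - {v}) - A `` {v}"
      using that by (auto simp: B_def)
    moreover have "A `` {v} \<subseteq> {..N} - {v}"
      using A(1,3) by (auto simp: irrefl_def)
    moreover have "card ({..N} - {v}) = N"
      using that by simp
    ultimately show ?thesis
      by (metis card_Diff_subset finite_Diff finite_atMost finite_subset)
  qed
  then have "(\<lambda>v. card (B `` {v})) ` {..N} = (\<lambda>v. N - card (A `` {v})) ` {..N}"
    by (intro image_cong) auto
  also have "\<dots> = (\<lambda>d. N - d) ` D"
    unfolding A(4)[symmetric] image_image ..
  finally have "(\<lambda>v. card (B `` {v})) ` {..N} = (\<lambda>d. N - d) ` D" .
  moreover have "B \<subseteq> {..N} \<times> {..N}" "sym B" "irrefl B"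
    using A(2) by (auto simp: B_def sym_def irrefl_def)
  ultimately show ?thesis
    unfolding is_degree_set_def by blast
qed

lemma is_degree_set_add_isolated:
  assumes "is_degree_set N D"
  shows "is_degree_set (Suc N) (insert 0 D)"
proof -
  obtain A where A: "A \<subseteq> {..N} \<times> {..N}" "sym A" "irrefl A" "(\<lambda>v. card (A `` {v})) ` {..N} = D"
    using assms unfolding is_degree_set_def by blast
  have "A `` {Suc N} = {}"
    using A(1) by auto
  then have "(\<lambda>v. card (A `` {v})) ` {..Suc N} = insert 0 D"
    using A(4) by (simp add: atMost_Suc)
  moreover have "A \<subseteq> {..Suc N} \<times> {..Suc N}"
    using A(1) by auto
  ultimately show ?thesis
    using A(2,3) unfolding is_degree_set_def by blast
qed

lemma is_degree_set_singleton_0: "is_degree_set N {0}"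
  unfolding is_degree_set_def by (intro exI[of _ "{}"]) (auto simp: sym_def irrefl_def)

text \<open>
  The condition on \<open>0\<close> and \<open>N\<close> is invariant under \<open>D \<mapsto> N - D\<close>, so that the induction only has to
  treat the case \<open>0 \<in> D\<close>.
\<close>

lemma degree_set_if_one_extreme:
  assumes "D \<subseteq> {..N}" and "(0 \<in> D) \<noteq> (N \<in> D)"
  shows "is_degree_set N D"
  using assms
proof (induction N arbitrary: D)
  case 0
  then show ?case by simp
next
  case (Suc N)
  have zero: "is_degree_set (Suc N) E" if E: "E \<subseteq> {..Suc N}" "0 \<in> E" "Suc N \<notin> E" for E
  proof (cases "E = {0}")
    case True
    then show ?thesis by (simp add: is_degree_set_singleton_0)
  next
    case False
    have sub: "E \<subseteq> {..N}"
      using E(1,3) by (auto simp: atMost_Suc)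
    with False E(2) have "N \<noteq> 0" by auto
    \<comment> \<open>The new isolated vertex has degree \<open>0\<close>, so the smaller graph may have degree set \<open>E\<close> or
      \<open>E - {0}\<close>; exactly one of them satisfies the induction hypothesis.\<close>
    define E' where "E' = (if N \<in> E then E - {0} else E)"
    have "is_degree_set N E'"
      using sub E(2) \<open>N \<noteq> 0\<close> by (intro Suc.IH) (auto simp: E'_def)
    then have "is_degree_set (Suc N) (insert 0 E')"
      by (rule is_degree_set_add_isolated)
    moreover have "insert 0 E' = E"
      using E(2) by (auto simp: E'_def)
    ultimately show ?thesis by simp
  qed
  show ?case
  proof (cases "0 \<in> D")
    case True
    with Suc.prems zero show ?thesis by blast
  next
    case False
    define E where "E = (\<lambda>d. Suc N - d) ` D"
    have "Suc N \<in> D"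
      using False Suc.prems(2) by simp
    then have "0 \<in> E"
      by (force simp: E_def)
    moreover have "Suc N \<notin> E"
    proof
      assume "Suc N \<in> E"
      then obtain d where "d \<in> D" "Suc N = Suc N - d" by (auto simp: E_def)
      then have "d = 0" by arith
      with False \<open>d \<in> D\<close> show False by simp
    qed
    ultimately have "is_degree_set (Suc N) E"
      by (intro zero) (auto simp: E_def)
    then have "is_degree_set (Suc N) ((\<lambda>d. Suc N - d) ` E)"
      by (rule is_degree_set_complement)
    moreover have "(\<lambda>d. Suc N - d) ` E = (\<lambda>d. d) ` D"
      unfolding E_def image_image using Suc.prems(1) by (intro image_cong) auto
    ultimately show ?thesis by simp
  qed
qed

section \<open>Signed degrees\<close>

lemma card_incident_edges:
  assumes "signed_graph G"
  shows "card {e \<in> edges G. v \<in> e} = card (parcs (underlying G) `` {v})"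
proof -
  interpret pair_graph "underlying G"
    using assms by (simp add: signed_graph_def)
  have "{e \<in> edges G. v \<in> e} = (\<lambda>w. {v, w}) ` (parcs (underlying G) `` {v})"
    using arcs_symmetric by (fastforce simp: edges_def)
  moreover have "inj_on (\<lambda>w. {v, w}) (parcs (underlying G) `` {v})"
    by (rule inj_onI) (auto simp: doubleton_eq_iff)
  ultimately show ?thesis
    by (simp add: card_image)
qed

lemma sdeg_all_positive:
  assumes "signed_graph G" and "\<And>e. e \<in> edges G \<Longrightarrow> is_positive G e"
  shows "sdeg G v = int (card (parcs (underlying G) `` {v}))"
proof -
  have pos: "{e \<in> edges G. v \<in> e \<and> is_positive G e} = {e \<in> edges G. v \<in> e}"
    and neg: "{e \<in> edges G. v \<in> e \<and> \<not> is_positive G e} = {}"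
    using assms(2) by auto
  show ?thesis
    unfolding sdeg_def pos neg using card_incident_edges[OF assms(1)] by simp
qed

lemma sdeg_less_order:
  assumes "signed_graph G" and v: "v \<in> vertices G"
  shows "sdeg G v < int (graph_order G)"
proof -
  interpret pair_graph "underlying G"
    using assms(1) by (simp add: signed_graph_def)
  have finV: "finite (vertices G)"
    using pair_finite_verts by (simp add: vertices_def)
  have "edges G \<subseteq> Pow (vertices G)"
    by (auto simp: edges_def vertices_def dest: in_arcsD1 in_arcsD2)
  then have "finite (edges G)"
    using finV by (meson finite_Pow_iff finite_subset)
  then have "card {e \<in> edges G. v \<in> e \<and> is_positive G e} \<le> card {e \<in> edges G. v \<in> e}"
    by (intro card_mono) auto
  also have "\<dots> = card (parcs (underlying G) `` {v})"
    by (rule card_incident_edges[OF assms(1)])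
  also have "\<dots> < card (vertices G)"
  proof (rule psubset_card_mono[OF finV])
    have "v \<notin> parcs (underlying G) `` {v}"
      using pair_no_loops by fastforce
    moreover have "parcs (underlying G) `` {v} \<subseteq> vertices G"
      by (auto simp: vertices_def dest: in_arcsD2)
    ultimately show "parcs (underlying G) `` {v} \<subset> vertices G"
      using v by blast
  qed
  finally show ?thesis
    by (simp add: sdeg_def graph_order_def)
qed

lemma Max_signed_degree_less_order:
  assumes "connected_signed_graph G" and "signed_degree_set G = D" and "finite D"
  shows "Max D < int (graph_order G)"
proof -
  have G: "signed_graph G" "vertices G \<noteq> {}"
    using assms(1)
    by (auto simp: connected_signed_graph_def vertices_def connected_conv)
  then have "Max D \<in> sdeg G ` vertices G"
    using assms(2,3) by (metis Max_in image_is_empty signed_degree_set_def)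
  then show ?thesis
    using sdeg_less_order[OF G(1)] by auto
qed

section \<open>A connected graph of minimum order\<close>

lemma connected_if_dominating_vertex:
  assumes "signed_graph G" and c: "c \<in> vertices G"
    and dom: "vertices G - {c} \<subseteq> parcs (underlying G) `` {c}"
  shows "connected_signed_graph G"
proof -
  interpret pair_graph "underlying G"
    using assms(1) by (simp add: signed_graph_def)
  let ?G = "with_proj (underlying G)"
  have from_c: "c \<rightarrow>\<^sup>*\<^bsub>?G\<^esub> v" if "v \<in> vertices G" for v
  proof (cases "v = c")
    case True
    then show ?thesis using c by (simp add: vertices_def)
  next
    case False
    then have "(c, v) \<in> parcs (underlying G)"
      using that dom by auto
    then show ?thesis by (intro reachable_adjI) simp
  qed
  have "u \<rightarrow>\<^sup>*\<^bsub>mk_symmetric ?G\<^esub> v" if "u \<in> vertices G" "v \<in> vertices G" for u v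
    using reachable_trans[OF symmetric_reachable'[OF from_c[OF that(1)]] from_c[OF that(2)]]
    by (rule reachable_mk_symmetricI)
  then have "Digraph_Component.connected ?G"
    unfolding connected_def using c
    by (intro strongly_connectedI) (auto simp: vertices_def mk_symmetric_def)
  then show ?thesis
    using assms(1) by (simp add: connected_signed_graph_def)
qed

lemma connected_signed_graph_of_degree_set:
  assumes "D \<subseteq> {..N}" and "0 \<notin> D" and "N \<in> D"
  shows "\<exists>G :: nat signed_graph.
    connected_signed_graph G \<and> signed_degree_set G = int ` D \<and> graph_order G = Suc N"
proof -
  have "is_degree_set N D"
    using assms by (intro degree_set_if_one_extreme) auto
  then obtain A where A: "A \<subseteq> {..N} \<times> {..N}" "sym A" "irrefl A"
      "(\<lambda>v. card (A `` {v})) ` {..N} = D"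
    unfolding is_degree_set_def by blast
  define G :: "nat signed_graph" where
    "G = \<lparr>underlying = \<lparr>pverts = {..N}, parcs = A\<rparr>, is_positive = (\<lambda>_. True)\<rparr>"
  have [simp]: "vertices G = {..N}" "parcs (underlying G) = A"
    by (simp_all add: G_def vertices_def)
  have "finite A"
    using A(1) by (rule finite_subset) simp
  then have G: "signed_graph G"
    unfolding signed_graph_def using A
    by unfold_locales (auto simp: G_def symmetric_def irrefl_def)
  have "sdeg G v = int (card (A `` {v}))" for v
    using sdeg_all_positive[OF G, of v] by (simp add: G_def)
  then have "signed_degree_set G = int ` D"
    unfolding A(4)[symmetric] image_image signed_degree_set_def by simp
  moreover have "connected_signed_graph G"
  proof -
    obtain c where c: "c \<le> N" "card (A `` {c}) = N"
      using assms(3) unfolding A(4)[symmetric] by auto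
    have "A `` {c} \<subseteq> {..N} - {c}"
      using A(1,3) by (auto simp: irrefl_def)
    then have "A `` {c} = {..N} - {c}"
      using c by (intro card_subset_eq) auto
    then show ?thesis
      using c by (intro connected_if_dominating_vertex[OF G, of c]) auto
  qed
  moreover have "graph_order G = Suc N"
    by (simp add: graph_order_def)
  ultimately show ?thesis by blast
qed

theorem theorem2p1:
  fixes D :: "int set" and N :: int
  assumes "finite D" and "D \<noteq> {}" and "\<And>d. d \<in> D \<Longrightarrow> d > 0"
    and "N = Max D"
  shows "(\<exists>G :: nat signed_graph. connected_signed_graph G \<and> signed_degree_set G = D) \<and>
    int (LEAST n. \<exists>G :: nat signed_graph.
           connected_signed_graph G \<and> signed_degree_set G = D \<and> graph_order G = n) = N + 1 \<and>
    (\<forall>H :: 'v signed_graph.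
       connected_signed_graph H \<and> signed_degree_set H = D \<longrightarrow> N + 1 \<le> int (graph_order H))"
proof -
  have N: "N \<in> D" "N > 0"
    using assms Max_in by auto
  have D: "0 < d \<and> d \<le> N" if "d \<in> D" for d
    using that assms by simp
  have "int ` nat ` D = D"
    using D by (force simp: image_image)
  moreover have "0 \<notin> nat ` D" "nat N \<in> nat ` D" "nat ` D \<subseteq> {..nat N}"
    using N D by fastforce+
  ultimately obtain G :: "nat signed_graph" where
    G: "connected_signed_graph G" "signed_degree_set G = D" "graph_order G = Suc (nat N)"
    using connected_signed_graph_of_degree_set[of "nat ` D" "nat N"] by auto
  \<comment> \<open>The bound is used at two vertex types: \<open>'v\<close> for the last claim and \<open>nat\<close> for the minimum.\<close>
  have lower: "N + 1 \<le> int (graph_order H)"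
    if "connected_signed_graph H" "signed_degree_set H = D" for H :: "'v signed_graph"
    using Max_signed_degree_less_order[OF that assms(1)] assms(4) by simp
  have lower_nat: "N + 1 \<le> int (graph_order H)"
    if "connected_signed_graph H" "signed_degree_set H = D" for H :: "nat signed_graph"
    using Max_signed_degree_less_order[OF that assms(1)] assms(4) by simp
  have "(LEAST n. \<exists>G :: nat signed_graph.
      connected_signed_graph G \<and> signed_degree_set G = D \<and> graph_order G = n) = Suc (nat N)"
    using G lower_nat N(2) by (intro Least_equality) fastforce+
  then show ?thesis
    using G lower N(2) by auto
qed

end
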